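(* Let $R$ be an associative ring with identity. Then $R$ is a weak ideal-Armendariz ring if and only if the polynomial ring $R[x]$ is a weak ideal-Armendariz ring.
   Context: Rings are associative with identity, not necessarily commutative; the indeterminate $x$ commutes with coefficients. For a ring $A$, $N(A)$ denotes the set of nilpotent elements of $A$, and for a polynomial $f$ over $A$, $C_{f}$ denotes the set of all coefficients of $f$. A ring $A$ is Armendariz if whenever $f(t),g(t)\in A[t]$ satisfy $f(t)g(t)=0$, then $ab=0$ for all $a\in C_{f}$, $b\in C_{g}$. A ring $A$ is weakly semicommutative if for any $a,b\in A$, $ab=0$ implies $arb\in N(A)$ for every $r\in A$. A ring is weak ideal-Armendariz if it is both Armendariz and weakly semicommutative. *)

theory Defs
  imports "HOL-Algebra.UnivPoly"
begin

(* UP A is defined, and is a ring, for every ring A, not only for commutative ones; its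
   product is the convolution of coefficient sequences, so the indeterminate is central. *)

definition nilpotents :: "('a, 'm) ring_scheme \<Rightarrow> 'a set" where
  "nilpotents A = {a \<in> carrier A. \<exists>n::nat. 0 < n \<and> a [^]\<^bsub>A\<^esub> n = \<zero>\<^bsub>A\<^esub>}"

definition coeffs_of :: "('a, 'm) ring_scheme \<Rightarrow> (nat \<Rightarrow> 'a) \<Rightarrow> 'a set" where
  "coeffs_of A f = range (coeff (UP A) f)"

definition armendariz :: "('a, 'm) ring_scheme \<Rightarrow> bool" where
  "armendariz A \<longleftrightarrow>
     (\<forall>f \<in> carrier (UP A). \<forall>g \<in> carrier (UP A).
        f \<otimes>\<^bsub>UP A\<^esub> g = \<zero>\<^bsub>UP A\<^esub> \<longrightarrow>
        (\<forall>a \<in> coeffs_of A f. \<forall>b \<in> coeffs_of A g. a \<otimes>\<^bsub>A\<^esub> b = \<zero>\<^bsub>A\<^esub>))"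

definition weakly_semicommutative :: "('a, 'm) ring_scheme \<Rightarrow> bool" where
  "weakly_semicommutative A \<longleftrightarrow>
     (\<forall>a \<in> carrier A. \<forall>b \<in> carrier A.
        a \<otimes>\<^bsub>A\<^esub> b = \<zero>\<^bsub>A\<^esub> \<longrightarrow>
        (\<forall>r \<in> carrier A. a \<otimes>\<^bsub>A\<^esub> r \<otimes>\<^bsub>A\<^esub> b \<in> nilpotents A))"

definition weak_ideal_armendariz :: "('a, 'm) ring_scheme \<Rightarrow> bool" where
  "weak_ideal_armendariz A \<longleftrightarrow> ring A \<and> armendariz A \<and> weakly_semicommutative A"

end

theory Submission
  imports Defs
begin

text \<open>
  In an Armendariz ring a nilpotent $c$ can be inserted into a vanishing product: if $uv = 0$, then
  $u(1 - cx)(1 + cx + c^2x^2 + \cdots)v = 0$, hence $ucv = 0$. Therefore every word in nilpotents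
  $a, b$ in which $a$ or $b$ occurs often enough vanishes, so the nilpotents are closed under
  addition. As $R[x]$ is again Armendariz (replace the outer variable by a high power of $x$), a
  polynomial with nilpotent coefficients is nilpotent, being a sum of nilpotent monomials. If
  $fg = 0$, then all products of coefficients of $f$ and $g$ vanish, so the coefficients of $fhg$
  are sums of nilpotents $a_i r b_j$.
\<close>

context UP_ring
begin

section \<open>Coefficients and monomials over a possibly noncommutative ring\<close>

lemma armendariz_iff:
  "armendariz R \<longleftrightarrow>
     (\<forall>f \<in> carrier P. \<forall>g \<in> carrier P. f \<otimes>\<^bsub>P\<^esub> g = \<zero>\<^bsub>P\<^esub> \<longrightarrow>
        (\<forall>i j. coeff P f i \<otimes> coeff P g j = \<zero>))"
  by (auto simp: armendariz_def coeffs_of_def P_def)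

lemma armendarizD:
  assumes "armendariz R" "f \<in> carrier P" "g \<in> carrier P" "f \<otimes>\<^bsub>P\<^esub> g = \<zero>\<^bsub>P\<^esub>"
  shows "coeff P f i \<otimes> coeff P g j = \<zero>"
  using assms by (simp add: armendariz_iff)

lemma coeff_monom_mult_if:
  assumes "c \<in> carrier R" "p \<in> carrier P"
  shows "coeff P (monom P c n \<otimes>\<^bsub>P\<^esub> p) k = (if n \<le> k then c \<otimes> coeff P p (k - n) else \<zero>)"
proof (cases "n \<le> k")
  case True
  then show ?thesis
    using coeff_monom_mult[OF assms, of n "k - n"] by simp
next
  case False
  then have "(\<Oplus>i \<in> {..k}. coeff P (monom P c n) i \<otimes> coeff P p (k - i)) = (\<Oplus>i \<in> {..k}. \<zero>)"
    using assms by (intro R.finsum_cong') auto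
  with False show ?thesis
    using assms by simp
qed

text \<open>The monomial commutes with each term of \<open>p\<close>, since \<open>\<one>\<close>
  commutes with every coefficient, and both sides are additive in \<open>p\<close>. This allows
  powers of x to be collected on the left although R need not be commutative.\<close>

lemma monom_one_central:
  assumes "p \<in> carrier P"
  shows "p \<otimes>\<^bsub>P\<^esub> monom P \<one> n = monom P \<one> n \<otimes>\<^bsub>P\<^esub> p"
proof -
  define q where "q = (\<lambda>i. monom P (coeff P p i) i)"
  have q: "q \<in> {..deg R p} \<rightarrow> carrier P"
    using assms by (simp add: q_def)
  have comm: "q i \<otimes>\<^bsub>P\<^esub> monom P \<one> n = monom P \<one> n \<otimes>\<^bsub>P\<^esub> q i" for i
    using assms monom_mult[of "coeff P p i" \<one> i n] monom_mult[of \<one> "coeff P p i" n i]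
    by (simp add: q_def add.commute del: monom_mult)
  have "(\<Oplus>\<^bsub>P\<^esub>i \<in> {..deg R p}. q i) = p"
    unfolding q_def by (rule up_repr[OF assms])
  moreover have "(\<Oplus>\<^bsub>P\<^esub>i \<in> {..deg R p}. q i) \<otimes>\<^bsub>P\<^esub> monom P \<one> n
      = monom P \<one> n \<otimes>\<^bsub>P\<^esub> (\<Oplus>\<^bsub>P\<^esub>i \<in> {..deg R p}. q i)"
    using q comm by (simp add: P.finsum_ldistr P.finsum_rdistr)
  ultimately show ?thesis by simp
qed

section \<open>Nilpotent elements of an Armendariz ring\<close>

lemma armendariz_nilpotent_insert:
  assumes A: "armendariz R" and u: "u \<in> carrier R" and v: "v \<in> carrier R"
    and uv: "u \<otimes> v = \<zero>" and c: "c \<in> nilpotents R"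
  shows "u \<otimes> c \<otimes> v = \<zero>"
proof -
  from c obtain n where cR: "c \<in> carrier R" and n: "c [^] (n::nat) = \<zero>"
    by (auto simp: nilpotents_def)
  have zero: "c [^] k = \<zero>" if "n \<le> k" for k :: nat
    using R.nat_pow_mult[OF cR, of n "k - n"] n that cR by simp
  \<comment> \<open>$f = u (1 - c x)$ and $g = (1 + c x + c^2 x^2 + \cdots) v$\<close>
  define f where "f = monom P u 0 \<ominus>\<^bsub>P\<^esub> monom P (u \<otimes> c) 1"
  define g where "g = (\<lambda>i::nat. c [^] i \<otimes> v)"
  \<comment> \<open>The geometric series breaks off because \<open>c [^] k\<close> vanishes from
    \<open>n\<close> on, so \<open>g\<close> is a polynomial.\<close>
  have "g \<in> up R"
    unfolding g_def using cR v zero by (intro mem_upI exI[of _ n]) auto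
  then have gP: "g \<in> carrier P" and cg: "coeff P g i = c [^] i \<otimes> v" for i
    by (simp_all add: P_def UP_def g_def)
  have fP: "f \<in> carrier P"
    unfolding f_def using u cR by simp
  have fg: "f \<otimes>\<^bsub>P\<^esub> g = monom P u 0 \<otimes>\<^bsub>P\<^esub> g \<ominus>\<^bsub>P\<^esub> monom P (u \<otimes> c) 1 \<otimes>\<^bsub>P\<^esub> g"
    unfolding f_def a_minus_def using u cR gP
    by (simp add: P.l_distr P.l_minus)
  have "f \<otimes>\<^bsub>P\<^esub> g = \<zero>\<^bsub>P\<^esub>"
  proof (rule up_eqI)
    fix k
    have "coeff P (f \<otimes>\<^bsub>P\<^esub> g) k
      = u \<otimes> (c [^] k \<otimes> v) \<ominus> (if 1 \<le> k then (u \<otimes> c) \<otimes> (c [^] (k - 1) \<otimes> v) else \<zero>)"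
      unfolding fg using u cR gP
      by (simp add: coeff_minus coeff_monom_mult_if cg del: coeff_mult One_nat_def)
    also have "\<dots> = \<zero>"
    \<comment> \<open>In degree 0 only uv = 0 remains; in degree k > 0 the terms u c^k v and
      (uc)(c^(k-1) v) cancel.\<close>
    proof (cases k)
      case 0
      then show ?thesis using u v uv by (simp add: a_minus_def)
    next
      case (Suc m)
      have "c \<otimes> c [^] m = c [^] Suc m"
        using R.nat_pow_Suc2[OF cR] by simp
      then have "(u \<otimes> c) \<otimes> (c [^] m \<otimes> v) = u \<otimes> (c [^] Suc m \<otimes> v)"
        using u v cR by (metis R.m_assoc R.m_closed R.nat_pow_closed)
      then show ?thesis
        using Suc u v cR by (simp add: a_minus_def R.r_neg)
    qed
    finally show "coeff P (f \<otimes>\<^bsub>P\<^esub> g) k = coeff P \<zero>\<^bsub>P\<^esub> k" by simp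
  qed (use fP gP in simp_all)
  \<comment> \<open>Coefficient 1 of \<open>f\<close> is -uc and coefficient 0 of \<open>g\<close>
    is v.\<close>
  from armendarizD[OF A fP gP this, of 1 0]
  have "\<ominus> (u \<otimes> c) \<otimes> v = \<zero>"
    using u cR v by (simp add: f_def coeff_minus cg a_minus_def)
  then show ?thesis
    using u cR v by (metis R.l_minus R.m_closed R.minus_equality R.minus_minus R.minus_zero)
qed

lemma armendariz_nilpotent_add:
  assumes A: "armendariz R" and a: "a \<in> nilpotents R" and b: "b \<in> nilpotents R"
  shows "a \<oplus> b \<in> nilpotents R"
proof -
  from a obtain n where aR: "a \<in> carrier R" and n: "0 < n" "a [^] (n::nat) = \<zero>"
    by (auto simp: nilpotents_def)
  from b obtain m where bR: "b \<in> carrier R" and m: "b [^] (m::nat) = \<zero>"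
    by (auto simp: nilpotents_def)
  \<comment> \<open>Here \<open>p\<close> stands for the word read so far, which \<open>i\<close>
    further factors a, or \<open>j\<close> further factors b, annihilate. Splitting off the leftmost
    factor of the power turns \<open>p\<close> into pa or pb. For pa, one a fewer is needed, and p
    b^j = 0 gives p a b^j = 0 by inserting a; symmetrically for pb. If \<open>i\<close> or
    \<open>j\<close> is 0, then \<open>p\<close> itself is 0.\<close>
  have vanish: "p \<otimes> (a \<oplus> b) [^] (i + j) = \<zero>"
    if "p \<in> carrier R" "p \<otimes> a [^] i = \<zero>" "p \<otimes> b [^] j = \<zero>" for p and i j :: nat
    using that
  proof (induction "i + j" arbitrary: p i j)
    case 0
    then show ?case by simp
  next
    case (Suc k)
    show ?case
    proof (cases "i = 0 \<or> j = 0")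
      case True
      then show ?thesis using Suc.prems aR bR by auto
    next
      case False
      then obtain i' j' where ij: "i = Suc i'" "j = Suc j'"
        by (meson not0_implies_Suc)
      have pa: "p \<otimes> a \<otimes> (a \<oplus> b) [^] (i' + j) = \<zero>"
      proof (rule Suc.hyps(1))
        show "k = i' + j" using Suc.hyps(2) ij by simp
        show "p \<otimes> a \<otimes> a [^] i' = \<zero>"
          using Suc.prems ij aR R.nat_pow_Suc2[OF aR, of i'] by (simp add: R.m_assoc)
        show "p \<otimes> a \<otimes> b [^] j = \<zero>"
          using armendariz_nilpotent_insert[OF A _ _ _ a] Suc.prems bR by simp
      qed (use Suc.prems aR in simp)
      have pb: "p \<otimes> b \<otimes> (a \<oplus> b) [^] (i + j') = \<zero>"
      proof (rule Suc.hyps(1))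
        show "k = i + j'" using Suc.hyps(2) ij by simp
        show "p \<otimes> b \<otimes> b [^] j' = \<zero>"
          using Suc.prems ij bR R.nat_pow_Suc2[OF bR, of j'] by (simp add: R.m_assoc)
        show "p \<otimes> b \<otimes> a [^] i = \<zero>"
          using armendariz_nilpotent_insert[OF A _ _ _ b] Suc.prems aR by simp
      qed (use Suc.prems bR in simp)
      have k: "i' + j = k" "i + j' = k" "i + j = Suc k"
        using Suc.hyps(2) ij by simp_all
      have "p \<otimes> (a \<oplus> b) [^] Suc k = (p \<otimes> a \<oplus> p \<otimes> b) \<otimes> (a \<oplus> b) [^] k"
        using Suc.prems(1) aR bR R.nat_pow_Suc2[of "a \<oplus> b" k]
        by (simp add: R.r_distr R.m_assoc[symmetric] del: R.nat_pow_Suc)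
      also have "\<dots> = \<zero>"
        using pa pb Suc.prems(1) aR bR unfolding k by (simp add: R.l_distr)
      finally show ?thesis unfolding k .
    qed
  qed
  have "(a \<oplus> b) [^] (n + m) = \<zero>"
    using vanish[of \<one> n m] n m aR bR by simp
  then show ?thesis
    unfolding nilpotents_def using aR bR n by (auto intro!: exI[of _ "n + m"])
qed

lemma armendariz_nilpotent_finsum:
  assumes A: "armendariz R" and "finite I" and "\<And>i. i \<in> I \<Longrightarrow> f i \<in> nilpotents R"
  shows "(\<Oplus>i \<in> I. f i) \<in> nilpotents R"
  using assms(2,3)
proof (induction I)
  case empty
  show ?case by (auto simp: nilpotents_def intro!: exI[of _ 1])
next
  case (insert i I)
  then have "f \<in> I \<rightarrow> carrier R" "f i \<in> carrier R"
    by (auto simp: nilpotents_def)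
  then show ?case
    using insert armendariz_nilpotent_add[OF A] by simp
qed

section \<open>The Armendariz property passes from R to R[x]\<close>

text \<open>Kronecker substitution: setting the outer variable to x^d packs the inner coefficients
  of F and of G into disjoint blocks of length d of two polynomials over R whose product is still 0.
  The hypothesis on R then annihilates all products of inner coefficients.\<close>

theorem armendariz_UP:
  assumes A: "armendariz R"
  shows "armendariz P"
proof -
  \<comment> \<open>The lemmas of this locale become available with R[x] as the coefficient
    ring.\<close>
  interpret Q: UP_ring P "UP P"
    by unfold_locales
  define Q where "Q = UP P"
  have "coeff Q F i \<otimes>\<^bsub>P\<^esub> coeff Q G j = \<zero>\<^bsub>P\<^esub>"
    if F: "F \<in> carrier Q" and G: "G \<in> carrier Q" and FG: "F \<otimes>\<^bsub>Q\<^esub> G = \<zero>\<^bsub>Q\<^esub>" for F G i j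
  proof -
    note F' = F[unfolded Q_def] and G' = G[unfolded Q_def]
    have cF [simp]: "coeff Q F i \<in> carrier P" and cG [simp]: "coeff Q G i \<in> carrier P" for i
      using Q.coeff_closed F' G' by (simp_all add: Q_def)
    define n where "n = deg P F"
    define m where "m = deg P G"
    \<comment> \<open>Substituting $x^d$ for the outer variable is injective on coefficients, because $d$
      exceeds every inner degree.\<close>
    define d where "d = Suc (Max ((\<lambda>i. deg R (coeff Q F i)) ` {..n} \<union> (\<lambda>i. deg R (coeff Q G i)) ` {..m}))"
    define subst where "subst = (\<lambda>H i. monom P \<one> (d * i) \<otimes>\<^bsub>P\<^esub> coeff Q H i)"
    have F0: "coeff Q F i = \<zero>\<^bsub>P\<^esub>" if "n < i" for i
      using Q.deg_aboveD[OF _ F'] that by (simp add: n_def Q_def)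
    have G0: "coeff Q G i = \<zero>\<^bsub>P\<^esub>" if "m < i" for i
      using Q.deg_aboveD[OF _ G'] that by (simp add: m_def Q_def)
    have Fd: "coeff P (coeff Q F i) j = \<zero>" if "d \<le> j" for i j
    proof (cases "i \<le> n")
      case True
      then have "deg R (coeff Q F i) < d"
        unfolding d_def by (auto intro!: le_imp_less_Suc Max_ge)
      then show ?thesis using that by (intro deg_aboveD) auto
    qed (simp add: F0)
    have Gd: "coeff P (coeff Q G i) j = \<zero>" if "d \<le> j" for i j
    proof (cases "i \<le> m")
      case True
      then have "deg R (coeff Q G i) < d"
        unfolding d_def by (auto intro!: le_imp_less_Suc Max_ge)
      then show ?thesis using that by (intro deg_aboveD) auto
    qed (simp add: G0)
    have coeff_subst: "coeff P (\<Oplus>\<^bsub>P\<^esub>l \<in> {..k}. subst H l) (d * i + j) = coeff P (coeff Q H i) j"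
      if H: "\<And>i. coeff Q H i \<in> carrier P" and H0: "\<And>i. k < i \<Longrightarrow> coeff Q H i = \<zero>\<^bsub>P\<^esub>"
        and Hd: "\<And>i j. d \<le> j \<Longrightarrow> coeff P (coeff Q H i) j = \<zero>" and j: "j < d" for H k i j
    proof -
      have sP: "subst H \<in> {..k} \<rightarrow> carrier P"
        by (simp add: subst_def H)
      have *: "coeff P (subst H l) (d * i + j) = (if i = l then coeff P (coeff Q H l) j else \<zero>)" for l
      \<comment> \<open>Only block \<open>l = i\<close> contributes to exponent d i + j: for l < i
        the inner exponent left over is at least d, where inner coefficients vanish; for l > i the
        shift d l already exceeds d i + j, as j < d.\<close>
      proof (cases l i rule: linorder_cases)
        case less
        then obtain e where "i = Suc (l + e)" using less_iff_Suc_add by auto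
        then have "d * i + j - d * l \<ge> d" and "d * l \<le> d * i + j"
          by (simp_all add: algebra_simps)
        then show ?thesis
          using less H Hd by (simp add: subst_def coeff_monom_mult_if del: coeff_mult)
      next
        case equal
        then show ?thesis
          using H by (simp add: subst_def coeff_monom_mult_if del: coeff_mult)
      next
        case greater
        then obtain e where "l = Suc (i + e)" using less_iff_Suc_add by auto
        then have "\<not> d * l \<le> d * i + j"
          using j by (simp add: algebra_simps)
        then show ?thesis
          using greater H by (simp add: subst_def coeff_monom_mult_if del: coeff_mult)
      qed
      have "coeff P (\<Oplus>\<^bsub>P\<^esub>l \<in> {..k}. subst H l) (d * i + j)
        = (\<Oplus>l \<in> {..k}. if i = l then coeff P (coeff Q H l) j else \<zero>)"
        using coeff_finsum[OF _ sP] * by simp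
      also have "\<dots> = coeff P (coeff Q H i) j"
      proof (cases "i \<le> k")
        case True
        then show ?thesis
          using R.finsum_singleton[of i "{..k}" "\<lambda>l. coeff P (coeff Q H l) j"] H by simp
      next
        case False
        then have "(\<Oplus>l \<in> {..k}. if i = l then coeff P (coeff Q H l) j else \<zero>) = (\<Oplus>l \<in> {..k}. \<zero>)"
          by (intro R.finsum_cong') auto
        with False show ?thesis by (simp add: H0)
      qed
      finally show ?thesis .
    qed
    have sF: "subst F i \<in> carrier P" and sG: "subst G i \<in> carrier P" for i
      by (simp_all add: subst_def)
    have "(\<Oplus>\<^bsub>P\<^esub>i \<in> {..n}. subst F i) \<otimes>\<^bsub>P\<^esub> (\<Oplus>\<^bsub>P\<^esub>i \<in> {..m}. subst G i)
      = (\<Oplus>\<^bsub>P\<^esub>k \<in> {..n + m}. \<Oplus>\<^bsub>P\<^esub>i \<in> {..k}. subst F i \<otimes>\<^bsub>P\<^esub> subst G (k - i))"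
      by (rule P.cauchy_product[symmetric])
         (auto simp: sF sG, auto simp: subst_def F0 G0)
    also have "\<dots> = (\<Oplus>\<^bsub>P\<^esub>k \<in> {..n + m}. \<zero>\<^bsub>P\<^esub>)"
    proof (rule P.finsum_cong')
      fix k
      \<comment> \<open>Moving x^(d(k-i)) to the left past the coefficient of F leaves the common
        factor x^(dk), so the inner sum is x^(dk) times coefficient k of FG = 0.\<close>
      have "subst F i \<otimes>\<^bsub>P\<^esub> subst G (k - i) =
        monom P \<one> (d * k) \<otimes>\<^bsub>P\<^esub> (coeff Q F i \<otimes>\<^bsub>P\<^esub> coeff Q G (k - i))" if "i \<le> k" for i
      proof -
        let ?x = "\<lambda>l. monom P \<one> (d * l)"
        have "?x i \<otimes>\<^bsub>P\<^esub> coeff Q F i \<otimes>\<^bsub>P\<^esub> (?x (k - i) \<otimes>\<^bsub>P\<^esub> coeff Q G (k - i))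
          = ?x i \<otimes>\<^bsub>P\<^esub> (coeff Q F i \<otimes>\<^bsub>P\<^esub> ?x (k - i)) \<otimes>\<^bsub>P\<^esub> coeff Q G (k - i)"
          by (simp add: P.m_assoc)
        also have "\<dots> = (?x i \<otimes>\<^bsub>P\<^esub> ?x (k - i)) \<otimes>\<^bsub>P\<^esub> (coeff Q F i \<otimes>\<^bsub>P\<^esub> coeff Q G (k - i))"
          unfolding monom_one_central[OF cF] by (simp add: P.m_assoc)
        also have "?x i \<otimes>\<^bsub>P\<^esub> ?x (k - i) = ?x k"
          using that by (simp add: monom_one_mult[symmetric] add_mult_distrib2[symmetric])
        finally show ?thesis by (simp add: subst_def)
      qed
      then have "(\<Oplus>\<^bsub>P\<^esub>i \<in> {..k}. subst F i \<otimes>\<^bsub>P\<^esub> subst G (k - i))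
        = (\<Oplus>\<^bsub>P\<^esub>i \<in> {..k}. monom P \<one> (d * k) \<otimes>\<^bsub>P\<^esub> (coeff Q F i \<otimes>\<^bsub>P\<^esub> coeff Q G (k - i)))"
        by (intro P.finsum_cong') auto
      also have "\<dots> = monom P \<one> (d * k) \<otimes>\<^bsub>P\<^esub> coeff Q (F \<otimes>\<^bsub>Q\<^esub> G) k"
        using F' G' cF cG by (simp add: P.finsum_rdistr Q.coeff_mult Q_def)
      also have "\<dots> = \<zero>\<^bsub>P\<^esub>"
        using Q.coeff_zero by (simp add: FG) (simp add: Q_def)
      finally show "(\<Oplus>\<^bsub>P\<^esub>i \<in> {..k}. subst F i \<otimes>\<^bsub>P\<^esub> subst G (k - i)) = \<zero>\<^bsub>P\<^esub>" .
    qed auto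
    finally have prod0:
      "(\<Oplus>\<^bsub>P\<^esub>i \<in> {..n}. subst F i) \<otimes>\<^bsub>P\<^esub> (\<Oplus>\<^bsub>P\<^esub>i \<in> {..m}. subst G i) = \<zero>\<^bsub>P\<^esub>"
      by simp
    \<comment> \<open>If both indices are below d, the factors are coefficients of the two
      substituted polynomials; otherwise one factor is 0.\<close>
    have "coeff P (coeff Q F i) a \<otimes> coeff P (coeff Q G j) b = \<zero>" for a b
    proof (cases "a < d \<and> b < d")
      case True
      then have "coeff P (coeff Q F i) a = coeff P (\<Oplus>\<^bsub>P\<^esub>l \<in> {..n}. subst F l) (d * i + a)"
        "coeff P (coeff Q G j) b = coeff P (\<Oplus>\<^bsub>P\<^esub>l \<in> {..m}. subst G l) (d * j + b)"
        using coeff_subst[of F n a i] coeff_subst[of G m b j] F0 G0 Fd Gd by auto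
      then show ?thesis
        using armendarizD[OF A _ _ prod0] sF sG by simp
    next
      case False
      then show ?thesis
        using Fd Gd by (auto simp: not_less)
    qed
    then show ?thesis
      by (intro up_eqI) (simp_all cong: R.finsum_cong)
  qed
  then show ?thesis
    by (simp add: Q.armendariz_iff Q_def)
qed

section \<open>Nilpotent polynomials and weak semicommutativity of R[x]\<close>

lemma monom_nilpotent:
  assumes "a \<in> nilpotents R"
  shows "monom P a k \<in> nilpotents P"
proof -
  from assms obtain n where a: "a \<in> carrier R" and n: "0 < n" "a [^] (n::nat) = \<zero>"
    by (auto simp: nilpotents_def)
  have "monom P a k [^]\<^bsub>P\<^esub> l = monom P (a [^] l) (k * l)" for l :: nat
  proof (induction l)
    case (Suc l)
    then show ?case
      using a monom_mult[of "a [^] l" a "k * l" k] by (simp add: add.commute del: monom_mult)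
  qed simp
  with n have "monom P a k [^]\<^bsub>P\<^esub> n = \<zero>\<^bsub>P\<^esub>" by simp
  with a n show ?thesis by (auto simp: nilpotents_def)
qed

lemma const_nilpotentD:
  assumes a: "a \<in> carrier R" and "monom P a 0 \<in> nilpotents P"
  shows "a \<in> nilpotents R"
proof -
  from assms obtain n where n: "0 < n" "monom P a 0 [^]\<^bsub>P\<^esub> (n::nat) = \<zero>\<^bsub>P\<^esub>"
    by (auto simp: nilpotents_def)
  have "monom P a 0 [^]\<^bsub>P\<^esub> l = monom P (a [^] l) 0" for l :: nat
  proof (induction l)
    case (Suc l)
    then show ?case
      using a monom_mult[of "a [^] l" a 0 0] by (simp del: monom_mult)
  qed simp
  with n have "monom P (a [^] n) 0 = \<zero>\<^bsub>P\<^esub>" by simp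
  then have "a [^] n = \<zero>"
    using a coeff_monom[of "a [^] n" 0 0] coeff_zero[of 0] by simp
  with a n show ?thesis by (auto simp: nilpotents_def)
qed

text \<open>Each term of \<open>f\<close> is a nilpotent monomial. Closure of nilpotents under sums
  is applied in R[x] here, which is legitimate by \<open>armendariz_UP\<close>.\<close>

lemma nilpotent_of_coeffs:
  assumes A: "armendariz R" and f: "f \<in> carrier P" and "\<And>i. coeff P f i \<in> nilpotents R"
  shows "f \<in> nilpotents P"
proof -
  interpret Q: UP_ring P "UP P"
    by unfold_locales
  have "(\<Oplus>\<^bsub>P\<^esub>i \<in> {..deg R f}. monom P (coeff P f i) i) \<in> nilpotents P"
    using assms by (intro Q.armendariz_nilpotent_finsum armendariz_UP monom_nilpotent) auto
  then show ?thesis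
    using up_repr[OF f] by simp
qed

theorem weakly_semicommutative_UP:
  assumes A: "armendariz R" and W: "weakly_semicommutative R"
  shows "weakly_semicommutative P"
  unfolding weakly_semicommutative_def
proof (intro ballI impI)
  fix f g h
  assume f: "f \<in> carrier P" and g: "g \<in> carrier P" and h: "h \<in> carrier P"
    and fg: "f \<otimes>\<^bsub>P\<^esub> g = \<zero>\<^bsub>P\<^esub>"
  \<comment> \<open>The outer two coefficients multiply to 0 by the Armendariz property, so weak
    semicommutativity of R applies with the coefficient of \<open>h\<close> in the middle.\<close>
  have coeff_nil: "coeff P f i \<otimes> coeff P h j \<otimes> coeff P g k \<in> nilpotents R" for i j k
    using W armendarizD[OF A f g fg] f g h by (simp add: weakly_semicommutative_def)
  show "f \<otimes>\<^bsub>P\<^esub> h \<otimes>\<^bsub>P\<^esub> g \<in> nilpotents P"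
  proof (rule nilpotent_of_coeffs[OF A])
    fix n
    have "coeff P (f \<otimes>\<^bsub>P\<^esub> h \<otimes>\<^bsub>P\<^esub> g) n
      = (\<Oplus>k \<in> {..n}. \<Oplus>i \<in> {..k}. coeff P f i \<otimes> coeff P h (k - i) \<otimes> coeff P g (n - k))"
      using f g h by (simp add: R.finsum_ldistr Pi_def cong: R.finsum_cong)
    also have "\<dots> \<in> nilpotents R"
      by (intro armendariz_nilpotent_finsum[OF A] coeff_nil finite_atMost)
    finally show "coeff P (f \<otimes>\<^bsub>P\<^esub> h \<otimes>\<^bsub>P\<^esub> g) n \<in> nilpotents R" .
  qed (use f g h in simp)
qed

section \<open>Descent from R[x] to R\<close>

theorem armendariz_if_UP:
  assumes A: "armendariz P"
  shows "armendariz R"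
  unfolding armendariz_iff
proof (intro ballI impI allI)
  interpret Q: UP_ring P "UP P"
    by unfold_locales
  fix f g i j
  assume f: "f \<in> carrier P" and g: "g \<in> carrier P" and fg: "f \<otimes>\<^bsub>P\<^esub> g = \<zero>\<^bsub>P\<^esub>"
  \<comment> \<open>A polynomial over R is read as one over R[x] with constant coefficients, the
    outer variable taking the place of x.\<close>
  define lift where "lift = (\<lambda>h i. monom P (coeff P h i) 0)"
  have lift: "lift h \<in> carrier (UP P)" "coeff (UP P) (lift h) = lift h" if h: "h \<in> carrier P" for h
  proof -
    have "lift h \<in> up P"
      unfolding lift_def using h deg_aboveD[OF _ h]
      by (intro mem_upI mem_upI exI[of _ "deg R h"]) auto
    then show "lift h \<in> carrier (UP P)" "coeff (UP P) (lift h) = lift h"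
      by (simp_all add: UP_def)
  qed
  \<comment> \<open>Additivity of the embedding of constants lets \<open>lift\<close> carry the
    convolution of \<open>f\<close> and \<open>g\<close> over, so the lifted product is also
    0.\<close>
  have sum: "(\<Oplus>\<^bsub>P\<^esub>i \<in> I. monom P (c i) 0) = monom P (\<Oplus>i \<in> I. c i) 0"
    if "c \<in> I \<rightarrow> carrier R" "finite I" for c and I :: "nat set"
    using that(2,1) by (induction I) (simp_all add: Pi_def)
  have "lift f \<otimes>\<^bsub>UP P\<^esub> lift g = \<zero>\<^bsub>UP P\<^esub>"
  proof (rule Q.up_eqI)
    fix k
    have "coeff (UP P) (lift f \<otimes>\<^bsub>UP P\<^esub> lift g) k
      = (\<Oplus>\<^bsub>P\<^esub>i \<in> {..k}. monom P (coeff P f i \<otimes> coeff P g (k - i)) 0)"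
      using lift f g monom_mult[of _ _ 0 0] by (simp add: lift_def del: monom_mult)
    also have "\<dots> = monom P (coeff P (f \<otimes>\<^bsub>P\<^esub> g) k) 0"
      using f g by (subst sum) auto
    finally show "coeff (UP P) (lift f \<otimes>\<^bsub>UP P\<^esub> lift g) k = coeff (UP P) \<zero>\<^bsub>UP P\<^esub> k"
      by (simp add: fg)
  qed (use lift f g in simp_all)
  from Q.armendarizD[OF A _ _ this, of i j]
  have "monom P (coeff P f i \<otimes> coeff P g j) 0 = \<zero>\<^bsub>P\<^esub>"
    using lift f g monom_mult[of _ _ 0 0] by (simp add: lift_def del: monom_mult)
  then show "coeff P f i \<otimes> coeff P g j = \<zero>"
    using f g coeff_monom[of "coeff P f i \<otimes> coeff P g j" 0 0] coeff_zero[of 0] by simp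
qed

text \<open>R embeds in R[x] as the constants, and nilpotency of a constant is reflected by
  \<open>const_nilpotentD\<close>.\<close>

theorem weakly_semicommutative_if_UP:
  assumes W: "weakly_semicommutative P"
  shows "weakly_semicommutative R"
  unfolding weakly_semicommutative_def
proof (intro ballI impI)
  fix a b r
  assume R: "a \<in> carrier R" "b \<in> carrier R" "r \<in> carrier R" and ab: "a \<otimes> b = \<zero>"
  have m: "monom P (x \<otimes> y) 0 = monom P x 0 \<otimes>\<^bsub>P\<^esub> monom P y 0"
    if "x \<in> carrier R" "y \<in> carrier R" for x y
    using monom_mult[OF that, of 0 0] by simp
  have "monom P a 0 \<otimes>\<^bsub>P\<^esub> monom P b 0 = \<zero>\<^bsub>P\<^esub>"
    using R ab m[symmetric] by simp
  then have "monom P a 0 \<otimes>\<^bsub>P\<^esub> monom P r 0 \<otimes>\<^bsub>P\<^esub> monom P b 0 \<in> nilpotents P"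
    using W R by (simp add: weakly_semicommutative_def)
  then show "a \<otimes> r \<otimes> b \<in> nilpotents R"
    using R by (intro const_nilpotentD) (simp_all add: m)
qed

end

theorem proposition2p1:
  fixes R :: "('a, 'm) ring_scheme"
  assumes "ring R"
  shows "weak_ideal_armendariz R \<longleftrightarrow> weak_ideal_armendariz (UP R)"
proof -
  interpret UP_ring R "UP R"
    using assms by (simp add: UP_ring_def)
  show ?thesis
    using assms UP_ring armendariz_UP armendariz_if_UP
      weakly_semicommutative_UP weakly_semicommutative_if_UP
    by (auto simp: weak_ideal_armendariz_def)
qed

end
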